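(* Let $\phi=\tilde p/p$ be a rational inner function with $\deg p=\deg\phi=(1,n)$, where $n\ge2$. Assume that $N_{\mathbb{T}^2}(p,\tilde p)=2n$, that $p$ is irreducible, and that all zeros of $p$ on $\mathbb{T}^2$ occur at $(1,1)$. Then $\phi$ is not in the Dirichlet space $\mathfrak D=\mathfrak D_1$ of the bidisk.
   Context: $p\in\mathbb{C}[z_1,z_2]$ has no zeros in $\mathbb{D}^2$, is atoral, and $\tilde p(z)=z_1^mz_2^n\overline{p(1/\bar z_1,1/\bar z_2)}$ for $\deg p=(m,n)$. $N_{\mathbb{T}^2}(p,\tilde p)$ denotes the sum over common zeros $\lambda\in\mathbb{T}^2$ of $p$ and $\tilde p$ of the intersection multiplicities $N_\lambda(p,\tilde p)$ (by Bézout this is at most $2mn$). $\mathfrak D$ is the space of holomorphic $f=\sum a_{k\ell}z_1^kz_2^\ell$ on $\mathbb{D}^2$ with $\sum_{k,\ell\ge0}(k+1)(\ell+1)|a_{k\ell}|^2<\infty$. *)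

theory Defs
  imports "HOL-Analysis.Analysis" "HOL-Computational_Algebra.Polynomial_Factorial"
    "HOL-Library.Extended_Nat"
begin

text \<open>Bivariate polynomials in C[z1,z2] are represented as complex poly poly:
  the outer variable is z1, the coefficients are polynomials in z2.\<close>

type_synonym bipoly = "complex poly poly"

definition eval2 :: "bipoly \<Rightarrow> complex \<Rightarrow> complex \<Rightarrow> complex" where
  "eval2 P z1 z2 = poly (poly P [:z1:]) z2"

definition deg2 :: "bipoly \<Rightarrow> nat \<times> nat" where
  "deg2 P = (degree P, Max ((\<lambda>k. degree (coeff P k)) ` {..degree P}))"

text \<open>Reflection: z1^m z2^n conj(P(1/conj z1, 1/conj z2)), written on coefficients.\<close>
definition refl2 :: "nat \<Rightarrow> nat \<Rightarrow> bipoly \<Rightarrow> bipoly" where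
  "refl2 m n P = (\<Sum>k\<le>m. \<Sum>l\<le>n. monom (monom (cnj (coeff (coeff P k) l)) (n - l)) (m - k))"

definition tilde :: "bipoly \<Rightarrow> bipoly" where
  "tilde P = refl2 (fst (deg2 P)) (snd (deg2 P)) P"

definition atoral :: "bipoly \<Rightarrow> bool" where
  "atoral P \<longleftrightarrow> (\<forall>D. D dvd P \<and> D dvd tilde P \<longrightarrow> is_unit D)"

text \<open>Membership in the ideal generated by P, Q in the local ring O_lambda
  of C[z1,z2] at lambda (rational functions regular at lambda).\<close>
definition in_local_ideal :: "complex \<times> complex \<Rightarrow> bipoly \<Rightarrow> bipoly \<Rightarrow> bipoly \<Rightarrow> bool" where
  "in_local_ideal lam P Q F \<longleftrightarrow>
     (\<exists>A B C. eval2 C (fst lam) (snd lam) \<noteq> 0 \<and> C * F = A * P + B * Q)"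

definition cscal :: "complex \<Rightarrow> bipoly \<Rightarrow> bipoly" where
  "cscal c F = [:[:c:]:] * F"

definition indep_mod :: "complex \<times> complex \<Rightarrow> bipoly \<Rightarrow> bipoly \<Rightarrow> bipoly set \<Rightarrow> bool" where
  "indep_mod lam P Q S \<longleftrightarrow>
     (\<forall>c. in_local_ideal lam P Q (\<Sum>F\<in>S. cscal (c F) F) \<longrightarrow> (\<forall>F\<in>S. c F = 0))"

text \<open>Intersection multiplicity N_lambda(P,Q) = dim_C O_lambda/(P,Q)
  (polynomials map onto this quotient, so the dimension is the supremal size
  of a family of polynomials independent modulo the ideal).\<close>
definition int_mult :: "bipoly \<Rightarrow> bipoly \<Rightarrow> complex \<times> complex \<Rightarrow> enat" where
  "int_mult P Q lam = Sup {enat (card S) | S. finite S \<and> indep_mod lam P Q S}"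

definition torus2 :: "(complex \<times> complex) set" where
  "torus2 = {(z1, z2). norm z1 = 1 \<and> norm z2 = 1}"

definition N_T2 :: "bipoly \<Rightarrow> bipoly \<Rightarrow> enat" where
  "N_T2 P Q = (\<Sum>lam\<in>{lam \<in> torus2. eval2 P (fst lam) (snd lam) = 0
                                   \<and> eval2 Q (fst lam) (snd lam) = 0}. int_mult P Q lam)"

definition dirichlet2 :: "(complex \<Rightarrow> complex \<Rightarrow> complex) \<Rightarrow> bool" where
  "dirichlet2 f \<longleftrightarrow> (\<exists>a :: nat \<Rightarrow> nat \<Rightarrow> complex.
      (\<forall>z1 z2. norm z1 < 1 \<and> norm z2 < 1 \<longrightarrow>
         ((\<lambda>(k, l). a k l * z1 ^ k * z2 ^ l) has_sum f z1 z2) UNIV) \<and>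
      (\<lambda>(k, l). real (k + 1) * real (l + 1) * (norm (a k l))\<^sup>2) summable_on UNIV)"

end

theory Submission
  imports Defs "HOL-Complex_Analysis.Riemann_Mapping"
begin

text \<open>Write \<open>p = a(z2) + z1 b(z2)\<close> and \<open>\<beta> = - b / a\<close>. The coefficient of \<open>z1 ^ k\<close> in \<open>\<phi>\<close> is
  \<open>c_k = \<beta> ^ (k - 1) * g\<close> for \<open>k \<ge> 1\<close>, where \<open>g = R / a ^ 2\<close> and \<open>R\<close> is the resultant of \<open>p\<close> and its
  reflection. On the circle \<open>|g| = 1 - |\<beta>| ^ 2\<close>, and \<open>R\<close> vanishes to some finite order \<open>M\<close> at \<open>1\<close>.
  The function \<open>\<beta>\<close> maps the disc into itself and \<open>\<beta> 1 = 1\<close>, so its derivative at \<open>1\<close> is nonzero.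
  At a point \<open>w\<close> with \<open>1 - |w| = 1 / k\<close> and \<open>|w - 1| ^ M\<close> comparable to \<open>1 / k\<close>, the power
  \<open>|\<beta> w| ^ k\<close> stays away from \<open>0\<close> and \<open>|g w|\<close> is of size \<open>1 / k\<close>, hence \<open>|c_k' w| \<ge> \<delta>\<close>. By
  Cauchy-Schwarz the Dirichlet energy of \<open>c_k\<close> is at least \<open>|c_k' w| ^ 2 (1 - |w|) ^ 2 \<ge> \<delta> ^ 2 / k ^ 2\<close>,
  and weighting these energies with \<open>k + 1\<close> leads to the harmonic series.\<close>

section \<open>Lower bounds for the Dirichlet energy\<close>

text \<open>Cauchy-Schwarz pairs \<open>sqrt (l + 1) * norm (u (l + 1))\<close> with
  \<open>sqrt (l + 1) * norm w ^ l\<close>; the second factor sums to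
  \<open>1 / (1 - x)\<^sup>2\<close> with \<open>x = (norm w)\<^sup>2\<close>, and
  \<open>1 - norm w \<le> 1 - x\<close>.\<close>

lemma deriv_powser_Cauchy_Schwarz:
  fixes u :: "nat \<Rightarrow> complex"
  assumes sums: "\<And>z. norm z < 1 \<Longrightarrow> (\<lambda>l. u l * z ^ l) sums f z"
    and energy: "summable (\<lambda>l. real (l + 1) * (norm (u l))\<^sup>2)"
    and f': "(f has_field_derivative D) (at w)" and w: "norm w < 1"
  shows "(norm D)\<^sup>2 * (1 - norm w)\<^sup>2 \<le> (\<Sum>l. real (l + 1) * (norm (u l))\<^sup>2)"
proof -
  define S where "S = (\<Sum>l. real (l + 1) * (norm (u l))\<^sup>2)"
  define x where "x = (norm w)\<^sup>2"
  have x: "0 \<le> x" "x < 1" "1 - norm w \<le> 1 - x"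
    using w abs_square_less_1[of "norm w"] by (auto simp: x_def power2_eq_square mult_left_le)
  have D: "(\<lambda>l. diffs u l * w ^ l) sums D"
    by (rule termdiffs_sums_strong[OF sums f' w])
  have x_sums: "(\<lambda>l. real (Suc l) * x ^ l) sums (1 / (1 - x)\<^sup>2)"
    using geometric_deriv_sums[of x] x by simp
  have energy': "summable (\<lambda>l. real (Suc l) * (norm (u (Suc l)))\<^sup>2)"
    by (rule summable_comparison_test'[OF summable_Suc_iff[THEN iffD2, OF energy], of 0])
       (auto intro!: mult_right_mono)
  \<comment> \<open>After the index shift of differentiation, \<open>u (Suc l)\<close> carries
    weight \<open>l + 1\<close> in place of \<open>l + 2\<close>; this and dropping the head term
    only lower the sum.\<close>
  have energy'_le: "(\<Sum>l. real (Suc l) * (norm (u (Suc l)))\<^sup>2) \<le> S"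
  proof -
    have "(\<Sum>l. real (Suc l) * (norm (u (Suc l)))\<^sup>2) \<le> (\<Sum>l. real (Suc l + 1) * (norm (u (Suc l)))\<^sup>2)"
      by (rule suminf_le[OF _ energy' summable_Suc_iff[THEN iffD2, OF energy]])
         (auto intro!: mult_right_mono)
    also have "\<dots> \<le> S"
      unfolding S_def using suminf_split_head[OF energy] by simp
    finally show ?thesis .
  qed
  have bound: "norm (\<Sum>l<N. diffs u l * w ^ l) ^ 2 \<le> S * (1 / (1 - x)\<^sup>2)" for N
  proof -
    have "norm (\<Sum>l<N. diffs u l * w ^ l) \<le>
        (\<Sum>l<N. (sqrt (real (Suc l)) * norm (u (Suc l))) * (sqrt (real (Suc l)) * norm w ^ l))"
    proof (rule order_trans[OF norm_sum], rule sum_mono)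
      fix l
      have "sqrt (real (Suc l)) * sqrt (real (Suc l)) = real (Suc l)" by simp
      then have "(sqrt (real (Suc l)) * norm (u (Suc l))) * (sqrt (real (Suc l)) * norm w ^ l)
          = real (Suc l) * norm (u (Suc l)) * norm w ^ l"
        by (metis mult.assoc mult.left_commute)
      then show "norm (diffs u l * w ^ l) \<le>
          (sqrt (real (Suc l)) * norm (u (Suc l))) * (sqrt (real (Suc l)) * norm w ^ l)"
        by (simp only: diffs_def norm_mult norm_power norm_of_nat order_refl)
    qed
    then have "norm (\<Sum>l<N. diffs u l * w ^ l) ^ 2 \<le>
        (\<Sum>l<N. (sqrt (real (Suc l)) * norm (u (Suc l))) * (sqrt (real (Suc l)) * norm w ^ l))\<^sup>2"
      by (intro power_mono) auto
    also have "\<dots> \<le> (\<Sum>l<N. (sqrt (real (Suc l)) * norm (u (Suc l)))\<^sup>2) *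
        (\<Sum>l<N. (sqrt (real (Suc l)) * norm w ^ l)\<^sup>2)"
      by (rule Cauchy_Schwarz_ineq_sum)
    also have "\<dots> = (\<Sum>l<N. real (Suc l) * (norm (u (Suc l)))\<^sup>2) * (\<Sum>l<N. real (Suc l) * x ^ l)"
      by (simp add: power_mult_distrib x_def mult.commute flip: power_mult)
    also have "\<dots> \<le> S * (1 / (1 - x)\<^sup>2)"
    proof (rule mult_mono)
      show "(\<Sum>l<N. real (Suc l) * (norm (u (Suc l)))\<^sup>2) \<le> S"
        by (rule order_trans[OF sum_le_suminf[OF energy'] energy'_le]) auto
      show "(\<Sum>l<N. real (Suc l) * x ^ l) \<le> 1 / (1 - x)\<^sup>2"
        using sum_le_suminf[OF sums_summable[OF x_sums], of "{..<N}"] sums_unique[OF x_sums] x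
        by simp
      show "0 \<le> S" unfolding S_def by (rule suminf_nonneg[OF energy]) auto
      show "0 \<le> (\<Sum>l<N. real (Suc l) * x ^ l)" using x by (intro sum_nonneg) auto
    qed
    finally show ?thesis .
  qed
  have "(\<lambda>N. norm (\<Sum>l<N. diffs u l * w ^ l) ^ 2) \<longlonglongrightarrow> (norm D)\<^sup>2"
    using D unfolding sums_def by (intro tendsto_intros)
  then have "(norm D)\<^sup>2 \<le> S * (1 / (1 - x)\<^sup>2)"
    by (rule LIMSEQ_le_const2) (use bound in blast)
  then have "(norm D)\<^sup>2 * (1 - x)\<^sup>2 \<le> S"
    using x by (simp add: field_simps)
  moreover have "(1 - norm w)\<^sup>2 \<le> (1 - x)\<^sup>2"
    using x w by (intro power_mono) auto
  ultimately show ?thesis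
    unfolding S_def by (meson mult_left_mono order_trans zero_le_power2)
qed

text \<open>A derivative of size \<delta> at distance at least \<open>1 / k\<close> from the circle
  forces row energy at least \<open>\<delta>\<^sup>2 / k\<^sup>2\<close>. The weight
  \<open>k + 1\<close> of the row turns this into a multiple of \<open>1 / k\<close>.\<close>

lemma Dirichlet_energy_diverges:
  fixes u :: "nat \<Rightarrow> nat \<Rightarrow> complex"
  assumes sums: "\<And>k z. k \<ge> 1 \<Longrightarrow> norm z < 1 \<Longrightarrow> (\<lambda>l. u k l * z ^ l) sums f k z"
    and "\<delta> > 0"
    and large: "\<forall>\<^sub>F k in sequentially. \<exists>w D. norm w \<le> 1 - 1 / real k \<and>
                  (f k has_field_derivative D) (at w) \<and> norm D \<ge> \<delta>"
  shows "\<not> (\<lambda>(k, l). real (k + 1) * real (l + 1) * (norm (u k l))\<^sup>2) summable_on UNIV"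
proof
  assume summ: "(\<lambda>(k, l). real (k + 1) * real (l + 1) * (norm (u k l))\<^sup>2) summable_on UNIV"
  then have summ': "(\<lambda>(k, l). real (k + 1) * real (l + 1) * (norm (u k l))\<^sup>2)
      summable_on (Sigma UNIV (\<lambda>_. UNIV))" by simp
  have row_on: "(\<lambda>l. real (k + 1) * real (l + 1) * (norm (u k l))\<^sup>2) summable_on UNIV" for k
    by (rule summable_on_SigmaD1[OF summ']) simp
  have row: "summable (\<lambda>l. real (k + 1) * real (l + 1) * (norm (u k l))\<^sup>2)" for k
    by (rule summable_on_imp_summable[OF row_on])
  define S where "S k = (\<Sum>l. real (l + 1) * (norm (u k l))\<^sup>2)" for k
  have row1: "summable (\<lambda>l. real (l + 1) * (norm (u k l))\<^sup>2)" for k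
    using row[of k] summable_cmult_iff[of "real (k + 1)" "\<lambda>l. real (l + 1) * (norm (u k l))\<^sup>2"]
    by (simp add: mult.assoc)
  have "(\<lambda>k. infsum (\<lambda>l. real (k + 1) * real (l + 1) * (norm (u k l))\<^sup>2) UNIV) summable_on UNIV"
    using summable_on_SigmaD[OF summ'] row_on by simp
  moreover have "infsum (\<lambda>l. real (k + 1) * real (l + 1) * (norm (u k l))\<^sup>2) UNIV = real (k + 1) * S k" for k
  proof -
    have "infsum (\<lambda>l. real (k + 1) * real (l + 1) * (norm (u k l))\<^sup>2) UNIV
        = (\<Sum>l. real (k + 1) * real (l + 1) * (norm (u k l))\<^sup>2)"
      by (rule sums_unique[OF has_sum_imp_sums[OF has_sum_infsum[OF row_on]]])
    also have "\<dots> = real (k + 1) * S k"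
      unfolding S_def suminf_mult[OF row1, symmetric] by (simp only: mult.assoc)
    finally show ?thesis .
  qed
  ultimately have summable: "summable (\<lambda>k. real (k + 1) * S k)"
    using summable_on_imp_summable by simp
  have "\<forall>\<^sub>F k in sequentially. norm (\<delta>\<^sup>2 * inverse (real k)) \<le> real (k + 1) * S k"
    using large eventually_ge_at_top[of 1]
  proof eventually_elim
    case (elim k)
    then obtain w D where w: "norm w \<le> 1 - 1 / real k" and
      D: "(f k has_field_derivative D) (at w)" "norm D \<ge> \<delta>" by blast
    have k: "real k > 0" using elim by simp
    then have "norm w < 1" using w by (smt (verit) divide_pos_pos)
    then have "(norm D)\<^sup>2 * (1 - norm w)\<^sup>2 \<le> S k"
      unfolding S_def by (intro deriv_powser_Cauchy_Schwarz[OF sums row1 D(1)] elim)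
    moreover have "\<delta>\<^sup>2 * (1 / real k)\<^sup>2 \<le> (norm D)\<^sup>2 * (1 - norm w)\<^sup>2"
      using D(2) w k \<open>\<delta> > 0\<close> by (intro mult_mono power_mono) auto
    ultimately have "\<delta>\<^sup>2 * (1 / real k)\<^sup>2 \<le> S k" by simp
    then have "real k * (\<delta>\<^sup>2 * (1 / real k)\<^sup>2) \<le> real (k + 1) * S k"
      using k by (intro mult_mono) auto
    moreover have "real k * (\<delta>\<^sup>2 * (1 / real k)\<^sup>2) = \<delta>\<^sup>2 * inverse (real k)"
      using k by (simp add: field_simps power2_eq_square)
    ultimately show ?case using k by simp
  qed
  then have "summable (\<lambda>k. \<delta>\<^sup>2 * inverse (real k))"
    by (rule summable_comparison_test_ev[OF _ summable])
  then have "summable (\<lambda>k. inverse (real k))"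
    using \<open>\<delta> > 0\<close> by (subst (asm) summable_cmult_iff) auto
  then show False using not_summable_harmonic[where 'a = real] by simp
qed

section \<open>Boundary geometry of the disc and uniqueness of power series\<close>

lemma exists_unimodular_at_distance:
  assumes "0 \<le> t" "t \<le> 2"
  shows "\<exists>\<zeta>::complex. norm \<zeta> = 1 \<and> norm (\<zeta> - 1) = t"
proof -
  have t: "t\<^sup>2 \<le> 4" using assms power_mono[of t 2 2] by simp
  \<comment> \<open>On the circle \<open>(norm (\<zeta> - 1))\<^sup>2 = 2 - 2 * Re \<zeta>\<close>,
    which dictates the real part; the imaginary part restores modulus 1.\<close>
  define \<zeta> where "\<zeta> = Complex (1 - t\<^sup>2 / 2) (t * sqrt (1 - t\<^sup>2 / 4))"
  have "(t * sqrt (1 - t\<^sup>2 / 4))\<^sup>2 = t\<^sup>2 * (1 - t\<^sup>2 / 4)"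
    using t by (simp add: power_mult_distrib)
  then have "(norm \<zeta>)\<^sup>2 = 1" "(norm (\<zeta> - 1))\<^sup>2 = t\<^sup>2"
    unfolding cmod_power2 \<zeta>_def by (simp_all add: power2_eq_square field_simps)
  then have "norm \<zeta> = 1 \<and> norm (\<zeta> - 1) = t"
    using assms by (metis norm_ge_zero power2_eq_iff_nonneg power2_eq_1_iff
        one_power2 zero_le_one)
  then show ?thesis by blast
qed

text \<open>Composing with the disc automorphism that sends \<open>f 0\<close> to \<open>0\<close> makes the Schwarz lemma
  applicable, and the bound \<open>norm (h r) \<le> r\<close> forbids a vanishing derivative at the boundary point.\<close>
lemma boundary_fixed_point_deriv_nonzero:
  assumes hol: "f holomorphic_on ball 0 1" and lt1: "\<And>z. norm z < 1 \<Longrightarrow> norm (f z) < 1"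
    and f1: "f 1 = 1" and f': "(f has_field_derivative D) (at 1)"
  shows "D \<noteq> 0"
proof
  assume "D = 0"
  define s where "s = f 0"
  have s: "norm s < 1" using lt1 by (simp add: s_def)
  then have s1: "1 - cnj s \<noteq> 0" by (metis complex_mod_cnj less_irrefl norm_one right_minus_eq)
  define h where "h = (\<lambda>z. Moebius_function 0 s (f z))"
  have h_eq: "h = (\<lambda>z. (f z - s) / (1 - cnj s * f z))"
    by (simp add: h_def Moebius_function_simple)
  have "h holomorphic_on ball 0 1"
    unfolding h_def
    by (rule holomorphic_on_compose_gen[OF hol Moebius_function_holomorphic[OF s, of 0], unfolded o_def])
       (use lt1 in auto)
  moreover have "h 0 = 0" by (simp add: h_eq s_def)
  moreover have "norm (h z) < 1" if "norm z < 1" for z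
    unfolding h_def by (intro Moebius_function_norm_lt_1 s lt1 that)
  ultimately have h_le: "norm (h z) \<le> norm z" if "norm z < 1" for z
    using Schwarz_Lemma(1)[of h z] that by blast
  have h1: "norm (h 1) = 1"
  proof -
    \<comment> \<open>Numerator and denominator of \<open>h 1\<close> are complex
      conjugates.\<close>
    have "norm (1 - cnj s) = norm (1 - s)"
      by (metis complex_cnj_diff complex_cnj_one complex_mod_cnj)
    then show ?thesis using s1 by (simp add: h_eq f1 norm_divide)
  qed
  have "(h has_field_derivative 0) (at 1)"
    unfolding h_eq using s1 f1 \<open>D = 0\<close>
    by (auto intro!: derivative_eq_intros f')
  then have "((\<lambda>y. (h y - h 1) / (y - 1)) \<longlongrightarrow> 0) (at 1)"
    by (simp add: has_field_derivative_iff)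
  then have "\<forall>\<^sub>F y in at 1. norm ((h y - h 1) / (y - 1)) < 1"
    by (auto simp: tendsto_iff dist_norm)
  then obtain d where d: "d > 0" "\<And>y. y \<noteq> 1 \<Longrightarrow> dist y 1 < d \<Longrightarrow> norm ((h y - h 1) / (y - 1)) < 1"
    unfolding eventually_at by auto
  \<comment> \<open>At this radial point \<open>1 - r \<le> norm (h 1) - norm (h y) \<le> norm (h y
    - h 1) < 1 - r\<close>, which is absurd.\<close>
  define r where "r = 1 - min (1/2) (d / 2)"
  have r: "0 < r" "r < 1" "1 - r < d" using d(1) by (auto simp: r_def min_def)
  define y where "y = complex_of_real r"
  have y1: "norm (y - 1) = 1 - r"
    unfolding y_def using r by (metis abs_minus_commute abs_of_pos diff_gt_0_iff_gt norm_of_real of_real_1 of_real_diff)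
  have "norm ((h y - h 1) / (y - 1)) < 1"
    by (rule d(2)) (use y1 r in \<open>auto simp: dist_norm\<close>)
  then have "norm (h y - h 1) < 1 - r"
    using y1 r by (simp add: norm_divide field_simps)
  moreover have "norm (h y) \<le> r" using h_le[of y] r by (simp add: y_def)
  ultimately show False
    using h1 norm_triangle_sub[of "h 1" "h y"] by (simp add: norm_minus_commute)
qed

text \<open>Differentiation lowers the index by one, so coefficient \<open>n + 1\<close> of
  \<open>f\<close> is read off from coefficient \<open>n\<close> of its derivative; the base case
  evaluates at 0.\<close>

lemma powser_coeff_unique:
  fixes c d :: "nat \<Rightarrow> complex"
  assumes "\<And>z. norm z < 1 \<Longrightarrow> (\<lambda>n. c n * z ^ n) sums f z"
    and "\<And>z. norm z < 1 \<Longrightarrow> (\<lambda>n. d n * z ^ n) sums f z"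
  shows "c n = d n"
  using assms
proof (induction n arbitrary: c d f)
  case 0
  have "c 0 = f 0" "d 0 = f 0"
    using 0(1)[of 0] 0(2)[of 0] powser_sums_zero_iff by force+
  then show ?case by simp
next
  case (Suc n)
  have f': "(f has_field_derivative deriv f z) (at z)" if "norm z < 1" for z
  proof -
    have "f holomorphic_on ball 0 1"
      by (rule power_series_holomorphic[where a = c]) (use Suc.prems(1) in simp)
    then show ?thesis using that holomorphic_derivI[of f "ball 0 1" z] by simp
  qed
  have "diffs c n = diffs d n"
  proof (rule Suc.IH)
    show "(\<lambda>n. diffs c n * z ^ n) sums deriv f z" if "norm z < 1" for z
      by (rule termdiffs_sums_strong[OF Suc.prems(1) f'[OF that] that])
    show "(\<lambda>n. diffs d n * z ^ n) sums deriv f z" if "norm z < 1" for z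
      by (rule termdiffs_sums_strong[OF Suc.prems(2) f'[OF that] that])
  qed
  then show ?case by (simp add: diffs_def del: of_nat_Suc)
qed

section \<open>Points where the row functions have large derivative\<close>

text \<open>The derivative is \<open>\<beta> ^ (k - 2)\<close> times
  \<open>(k - 1) * deriv \<beta> * g + \<beta> * deriv g\<close>. At
  \<open>w = (1 - 1 / k) * \<zeta>\<close> with \<open>norm (\<zeta> - 1) ^ M = A / k\<close>, the
  power stays bounded below, and for large \<open>A\<close> the first summand dominates the
  second.\<close>

lemma exists_points_with_large_deriv:
  fixes \<beta> g :: "complex \<Rightarrow> complex"
  assumes S: "open S" "1 \<in> S" and hol: "\<beta> holomorphic_on S" "g holomorphic_on S"
    and \<beta>1: "\<beta> 1 = 1" and \<beta>'1: "deriv \<beta> 1 \<noteq> 0"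
    and "M \<ge> 1" and "C \<ge> 0" and "c > 0"
    and \<beta>_ge: "\<And>\<zeta>. \<zeta> \<in> S \<Longrightarrow> norm \<zeta> = 1 \<Longrightarrow> norm (\<beta> \<zeta>) \<ge> 1 - C * norm (\<zeta> - 1) ^ M"
    and g_ge: "\<And>w. w \<in> S \<Longrightarrow> norm (g w) \<ge> c * norm (w - 1) ^ M"
  shows "\<exists>\<delta>>0. \<forall>\<^sub>F k in sequentially. \<exists>w D. norm w \<le> 1 - 1 / real k \<and>
           ((\<lambda>z. \<beta> z ^ (k - 1) * g z) has_field_derivative D) (at w) \<and> norm D \<ge> \<delta>"
proof -
  have hol': "deriv \<beta> holomorphic_on S" "deriv g holomorphic_on S"
    using hol S by (auto intro: holomorphic_deriv)
  obtain \<rho>0 where \<rho>0: "\<rho>0 > 0" "cball 1 \<rho>0 \<subseteq> S" using S open_contains_cball by blast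
  define m where "m = norm (deriv \<beta> 1) / 2"
  have m: "m > 0" using \<beta>'1 by (simp add: m_def)
  have "isCont (deriv \<beta>) 1"
    using hol'(1) S by (meson analytic_at analytic_at_imp_isCont)
  then have "\<forall>\<^sub>F z in nhds 1. dist (deriv \<beta> z) (deriv \<beta> 1) < m"
    using m unfolding isCont_def tendsto_iff eventually_at_filter
    by (auto elim!: eventually_mono allE[of _ m])
  then obtain \<rho>1 where \<rho>1: "\<rho>1 > 0" "\<And>z. dist z 1 < \<rho>1 \<Longrightarrow> dist (deriv \<beta> z) (deriv \<beta> 1) < m"
    unfolding eventually_nhds_metric by blast
  \<comment> \<open>Halving \<open>\<rho>1\<close> puts the closed ball inside the open ball on
    which \<open>deriv \<beta>\<close> keeps at least half of its modulus at 1.\<close>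
  define \<rho> where "\<rho> = min \<rho>0 (\<rho>1 / 2)"
  define B where "B = cball (1::complex) \<rho>"
  have \<rho>: "\<rho> > 0" and BS: "B \<subseteq> S" using \<rho>0 \<rho>1 by (auto simp: \<rho>_def B_def)
  have convex_B: "convex B" by (simp add: B_def)
  have \<beta>'_ge: "norm (deriv \<beta> z) \<ge> m" if "z \<in> B" for z
  proof -
    have "dist (deriv \<beta> z) (deriv \<beta> 1) < m"
      by (rule \<rho>1(2)) (use that \<rho>1(1) in \<open>auto simp: B_def \<rho>_def dist_commute min_def split: if_splits\<close>)
    moreover have "norm (deriv \<beta> 1) \<le> norm (deriv \<beta> z) + dist (deriv \<beta> z) (deriv \<beta> 1)"
      using norm_triangle_sub[of "deriv \<beta> 1" "deriv \<beta> z"] by (simp add: dist_norm norm_minus_commute)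
    ultimately show ?thesis by (simp add: m_def)
  qed
  have bounded: "\<exists>K. K > 0 \<and> (\<forall>z\<in>B. norm (f z) \<le> K)" if "f holomorphic_on S" for f
  proof -
    have "compact (f ` B)"
      using holomorphic_on_imp_continuous_on[OF holomorphic_on_subset[OF that BS]]
      by (intro compact_continuous_image) (auto simp: B_def)
    then show ?thesis using compact_imp_bounded bounded_pos by (auto dest!: compact_imp_bounded simp: bounded_pos)
  qed
  obtain L where L: "L > 0" "\<And>z. z \<in> B \<Longrightarrow> norm (deriv \<beta> z) \<le> L" using bounded[OF hol'(1)] by blast
  obtain G where G: "G > 0" "\<And>z. z \<in> B \<Longrightarrow> norm (deriv g z) \<le> G" using bounded[OF hol'(2)] by blast
  obtain K where K: "K > 0" "\<And>z. z \<in> B \<Longrightarrow> norm (\<beta> z) \<le> K" using bounded[OF hol(1)] by blast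
  \<comment> \<open>\<open>A\<close> is chosen so that the term with \<open>deriv \<beta>\<close> dominates the one with \<open>deriv g\<close>.\<close>
  define A where "A = max (2 ^ M) ((1 + K * G) * 2 ^ (M + 1) / (m * c))"
  have A: "A \<ge> 2 ^ M" "A > 0" "m * c * A / 2 ^ (M + 1) \<ge> 1 + K * G"
  proof -
    show "A \<ge> 2 ^ M" by (simp add: A_def)
    then show "A > 0" by (rule less_le_trans[rotated]) simp
    have "(1 + K * G) * 2 ^ (M + 1) / (m * c) \<le> A" by (simp add: A_def)
    then show "m * c * A / 2 ^ (M + 1) \<ge> 1 + K * G"
      using m \<open>c > 0\<close> by (simp add: field_simps)
  qed
  \<comment> \<open>\<open>E / k\<close> bounds the total loss in \<open>norm (\<beta> w)\<close>:
    \<open>C * A / k\<close> at the boundary point \<zeta>, and \<open>L / k\<close> for the radial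
    move of length \<open>1 / k\<close>.\<close>
  define E where "E = C * A + L"
  have E: "E \<ge> 0" using \<open>C \<ge> 0\<close> A L by (simp add: E_def)
  define t where "t k = root M (A / real k)" for k
  have t_lim: "t \<longlonglongrightarrow> 0"
  proof -
    have "(\<lambda>k. root M (A / real k)) \<longlonglongrightarrow> root M 0"
      by (intro tendsto_real_root lim_const_over_n)
    then show ?thesis by (simp add: t_def[abs_def])
  qed
  have exp_lim: "(\<lambda>k. (1 + (- E) / real k) ^ k) \<longlonglongrightarrow> exp (- E)"
    by (rule tendsto_exp_limit_sequentially)
  have "\<forall>\<^sub>F k in sequentially. t k < min 2 (\<rho> / 2)"
    using \<rho> by (intro order_tendstoD(2)[OF t_lim]) auto
  moreover have "\<forall>\<^sub>F k in sequentially. (1 + (- E) / real k) ^ k > exp (- E) / 2"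
    by (rule order_tendstoD(1)[OF exp_lim]) simp
  moreover have "\<forall>\<^sub>F k in sequentially. E / real k < 1"
    by (rule order_tendstoD(2)[OF lim_const_over_n]) simp
  moreover have "\<forall>\<^sub>F k in sequentially. 1 / real k < \<rho> / 2"
    using \<rho> by (intro order_tendstoD(2)[OF lim_const_over_n]) auto
  ultimately have "\<forall>\<^sub>F k in sequentially. \<exists>w D. norm w \<le> 1 - 1 / real k \<and>
           ((\<lambda>z. \<beta> z ^ (k - 1) * g z) has_field_derivative D) (at w) \<and> norm D \<ge> exp (- E) / 2"
    using eventually_ge_at_top[of 2]
  proof eventually_elim
    case (elim k)
    define h where "h = 1 / real k"
    have k: "real k \<ge> 2" using elim by simp
    have h: "0 < h" "h \<le> 1/2" "h < \<rho> / 2" using k elim by (auto simp: h_def field_simps)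
    have tM: "t k ^ M = A * h"
      using \<open>M \<ge> 1\<close> A k by (simp add: t_def h_def)
    have t: "0 \<le> t k" "t k \<le> 2" "t k < \<rho> / 2" using elim A \<open>M \<ge> 1\<close> by (auto simp: t_def real_root_ge_zero)
    \<comment> \<open>This is what \<open>A \<ge> 2 ^ M\<close> is for: the radial move by
      \<open>h\<close> then uses up at most half of the distance of \<zeta> from 1.\<close>
    have t_ge: "t k \<ge> 2 * h"
    proof (rule power_le_imp_le_base)
      show "0 \<le> t k" by fact
      obtain M' where M': "M = Suc M'" using \<open>M \<ge> 1\<close> by (cases M) auto
      have "(2 * h) ^ M \<le> 2 ^ M * h"
        using h power_le_one[of h M'] unfolding M' power_mult_distrib by (simp add: mult_left_le)
      also have "\<dots> \<le> A * h" using A h by (intro mult_right_mono) auto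
      finally show "(2 * h) ^ Suc (M - 1) \<le> t k ^ Suc (M - 1)" using tM M' by simp
    qed
    obtain \<zeta> :: complex where \<zeta>: "norm \<zeta> = 1" "norm (\<zeta> - 1) = t k"
      using exists_unimodular_at_distance[OF t(1,2)] by blast
    define w where "w = of_real (1 - h) * \<zeta>"
    have w\<zeta>: "norm (\<zeta> - w) = h"
    proof -
      have "\<zeta> - w = of_real h * \<zeta>" by (simp add: w_def algebra_simps)
      then show ?thesis using \<zeta> h by (simp add: norm_mult)
    qed
    have w_norm: "norm w = 1 - h" using h \<zeta> by (simp add: w_def norm_mult del: of_real_diff)
    have w1: "norm (w - 1) \<ge> t k / 2"
      using norm_triangle_ineq[of "\<zeta> - w" "w - 1"] w\<zeta> \<zeta> t_ge by simp
    have "norm (w - 1) \<le> \<rho>"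
      using norm_triangle_ineq[of "w - \<zeta>" "\<zeta> - 1"] w\<zeta> \<zeta> t h by (simp add: norm_minus_commute)
    then have wB: "w \<in> B" by (simp add: B_def dist_norm norm_minus_commute)
    have \<zeta>B: "\<zeta> \<in> B" using \<zeta> t \<rho> by (simp add: B_def dist_norm norm_minus_commute)
    have deriv\<beta>: "(\<beta> has_field_derivative deriv \<beta> z) (at z)" if "z \<in> B" for z
      using that BS hol(1) S holomorphic_derivI by blast
    have derivg: "(g has_field_derivative deriv g z) (at z)" if "z \<in> B" for z
      using that BS hol(2) S holomorphic_derivI by blast
    \<comment> \<open>The lower bound on \<beta> is given on the circle only; the mean value
      inequality on the convex set \<open>B\<close> carries it to \<open>w\<close>.\<close>
    have "norm (\<beta> \<zeta> - \<beta> w) \<le> L * norm (\<zeta> - w)"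
      by (rule field_differentiable_bound[where S = B and f' = "deriv \<beta>"])
         (auto intro: deriv\<beta> has_field_derivative_at_within L wB \<zeta>B convex_B)
    moreover have "norm (\<beta> \<zeta>) \<ge> 1 - C * (A * h)"
      using \<beta>_ge[of \<zeta>] \<zeta> \<zeta>B BS tM by auto
    ultimately have \<beta>w: "norm (\<beta> w) \<ge> 1 - E * h"
      using norm_triangle_sub[of "\<beta> \<zeta>" "\<beta> w"] w\<zeta> by (simp add: E_def algebra_simps)
    have Eh: "0 \<le> 1 - E * h" "1 - E * h \<le> 1" "1 - E * h = 1 + (- E) / real k"
      using elim E h by (auto simp: h_def)
    have "exp (- E) / 2 \<le> (1 - E * h) ^ k" using elim Eh by simp
    also have "\<dots> \<le> (1 - E * h) ^ (k - 2)" using Eh by (intro power_decreasing) auto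
    also have "\<dots> \<le> norm (\<beta> w) ^ (k - 2)" using \<beta>w Eh by (intro power_mono) auto
    finally have pow: "exp (- E) / 2 \<le> norm (\<beta> w) ^ (k - 2)" .
    define D where "D = \<beta> w ^ (k - 2) * (of_nat (k - 1) * deriv \<beta> w * g w + \<beta> w * deriv g w)"
    define j where "j = k - 2"
    have j: "k = Suc (Suc j)" using k by (simp add: j_def)
    have "((\<lambda>z. \<beta> z ^ (k - 1) * g z) has_field_derivative D) (at w)"
      using DERIV_mult[OF DERIV_power[OF deriv\<beta>[OF wB], of "k - 1"] derivg[OF wB]]
      by (rule DERIV_cong) (simp add: D_def j algebra_simps)
    moreover have "norm D \<ge> exp (- E) / 2"
    proof -
      have "c * (t k / 2) ^ M \<le> norm (g w)"
        using g_ge[of w] wB BS w1 t \<open>c > 0\<close>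
        by (intro order_trans[OF mult_left_mono[OF power_mono[OF w1]] g_ge]) auto
      then have gw: "c * A * h / 2 ^ M \<le> norm (g w)" by (simp add: power_divide tM)
      \<comment> \<open>Of the factor \<open>2 ^ (M + 1)\<close>, the part \<open>2 ^ M\<close> pays
        for \<open>norm (w - 1) \<ge> t k / 2\<close> and the remaining 2 for
        \<open>k - 1 \<ge> k / 2\<close>.\<close>
      have "1 + K * G \<le> m * c * A / 2 ^ (M + 1)" by (rule A)
      also have "\<dots> = real k / 2 * (m * (c * A * h / 2 ^ M))"
        using k by (simp add: h_def field_simps)
      also have "\<dots> \<le> real (k - 1) * (norm (deriv \<beta> w) * norm (g w))"
        using k h A m \<open>c > 0\<close> \<beta>'_ge[OF wB] gw by (intro mult_mono) auto
      finally have "norm (of_nat (k - 1) * deriv \<beta> w * g w) \<ge> 1 + K * G"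
        by (simp add: norm_mult)
      moreover have "norm (\<beta> w * deriv g w) \<le> K * G"
        unfolding norm_mult using K G wB by (intro mult_mono) auto
      ultimately have "norm (of_nat (k - 1) * deriv \<beta> w * g w + \<beta> w * deriv g w) \<ge> 1"
        using norm_diff_ineq[of "of_nat (k - 1) * deriv \<beta> w * g w" "\<beta> w * deriv g w"] by linarith
      then have "exp (- E) / 2 * 1 \<le> norm D"
        unfolding D_def norm_mult[of "\<beta> w ^ (k - 2)"] norm_power
        using pow by (intro mult_mono) auto
      then show ?thesis by simp
    qed
    moreover have "norm w \<le> 1 - 1 / real k" using w_norm by (simp add: h_def)
    ultimately show ?case by blast
  qed
  then show ?thesis by (intro exI[of _ "exp (- E) / 2"]) auto
qed

section \<open>Reflection and the expansion in \<open>z1\<close> for degree 1\<close>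

text \<open>On the circle \<open>cnj \<zeta>\<close> is the inverse of \<zeta>, so
  \<open>\<zeta> ^ n * cnj \<zeta> ^ l = \<zeta> ^ (n - l)\<close>.\<close>

lemma poly_reflect_unimodular:
  fixes a :: "complex poly"
  assumes "degree a \<le> n" "norm \<zeta> = 1"
  shows "poly (\<Sum>l\<le>n. monom (cnj (coeff a l)) (n - l)) \<zeta> = \<zeta> ^ n * cnj (poly a \<zeta>)"
proof -
  have inv: "\<zeta> * cnj \<zeta> = 1" using assms(2) by (simp flip: complex_norm_square)
  have "poly a \<zeta> = (\<Sum>l\<le>n. coeff a l * \<zeta> ^ l)"
    unfolding poly_altdef using assms(1)
    by (intro sum.mono_neutral_left) (auto simp: coeff_eq_0)
  then have "\<zeta> ^ n * cnj (poly a \<zeta>) = (\<Sum>l\<le>n. \<zeta> ^ n * (cnj (coeff a l) * cnj \<zeta> ^ l))"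
    by (simp add: sum_distrib_left)
  also have "\<dots> = (\<Sum>l\<le>n. cnj (coeff a l) * \<zeta> ^ (n - l))"
  proof (rule sum.cong[OF refl])
    fix l assume "l \<in> {..n}"
    then have "\<zeta> ^ n = \<zeta> ^ (n - l) * \<zeta> ^ l" by (simp flip: power_add)
    then show "\<zeta> ^ n * (cnj (coeff a l) * cnj \<zeta> ^ l) = cnj (coeff a l) * \<zeta> ^ (n - l)"
      using inv by (simp add: power_mult_distrib[symmetric] mult.assoc mult.left_commute)
  qed
  finally show ?thesis by (simp add: poly_sum poly_monom)
qed

lemma eval2_degree_le_1:
  assumes "degree P \<le> 1"
  shows "eval2 P z1 z2 = poly (coeff P 0) z2 + z1 * poly (coeff P 1) z2"
proof -
  have "P = [:coeff P 0, coeff P 1:]"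
    using assms by (intro poly_eqI) (auto simp: coeff_pCons coeff_eq_0 split: nat.split)
  then have "eval2 P z1 z2 = eval2 [:coeff P 0, coeff P 1:] z1 z2" by simp
  then show ?thesis by (simp add: eval2_def)
qed

text \<open>For degree 1 in \<open>z1\<close> the reflection sends index \<open>k\<close> to
  \<open>1 - k\<close>: it exchanges the two coefficients and reflects each of them in
  \<open>z2\<close>.\<close>

lemma eval2_tilde_degree_1:
  assumes "deg2 P = (1, n)"
  shows "eval2 (tilde P) z1 z2 = poly (\<Sum>l\<le>n. monom (cnj (coeff (coeff P 1) l)) (n - l)) z2
           + z1 * poly (\<Sum>l\<le>n. monom (cnj (coeff (coeff P 0) l)) (n - l)) z2"
proof -
  have "tilde P = (\<Sum>l\<le>n. monom (monom (cnj (coeff (coeff P 0) l)) (n - l)) 1)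
      + (\<Sum>l\<le>n. monom (monom (cnj (coeff (coeff P 1) l)) (n - l)) 0)"
    by (simp add: tilde_def refl2_def assms)
  then show ?thesis
    by (simp add: eval2_def poly_sum poly_monom sum_distrib_left mult.commute)
qed

text \<open>Subtracting \<open>s / a\<close> from the quotient leaves
  \<open>z * (r * a - b * s) / a\<^sup>2\<close> times the geometric series in
  \<open>(- b / a) * z\<close>, which converges on the disc because
  \<open>norm b \<le> norm a\<close>.\<close>

lemma fractional_linear_coeffs:
  fixes u :: "nat \<Rightarrow> complex"
  assumes sums: "\<And>z. norm z < 1 \<Longrightarrow> (\<lambda>k. u k * z ^ k) sums ((s + z * r) / (a + z * b))"
    and "a \<noteq> 0" and ba: "norm b \<le> norm a" and "k \<ge> 1"
  shows "u k = (- b / a) ^ (k - 1) * ((r * a - b * s) / a\<^sup>2)"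
proof -
  define \<beta> where "\<beta> = - b / a"
  define d where "d k = (if k = 0 then s / a else \<beta> ^ (k - 1) * ((r * a - b * s) / a\<^sup>2))" for k
  have "(\<lambda>k. d k * z ^ k) sums ((s + z * r) / (a + z * b))" if z: "norm z < 1" for z
  proof -
    have "norm (\<beta> * z) < 1"
    proof -
      have "norm \<beta> \<le> 1" using ba \<open>a \<noteq> 0\<close> by (simp add: \<beta>_def norm_divide)
      then have "norm \<beta> * norm z \<le> 1 * norm z" by (intro mult_right_mono) auto
      then show ?thesis using z by (simp add: norm_mult)
    qed
    then have geo: "(\<lambda>k. (\<beta> * z) ^ k) sums (1 / (1 - \<beta> * z))" and ne: "1 - \<beta> * z \<noteq> 0"
      by (auto simp: geometric_sums)
    have ab: "a + z * b = a * (1 - \<beta> * z)" using \<open>a \<noteq> 0\<close> by (simp add: \<beta>_def field_simps)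
    have "(\<lambda>k. d (Suc k) * z ^ Suc k) sums ((r * a - b * s) / a\<^sup>2 * z * (1 / (1 - \<beta> * z)))"
      using sums_mult[OF geo, of "(r * a - b * s) / a\<^sup>2 * z"]
      by (simp add: d_def power_mult_distrib mult_ac)
    then have "(\<lambda>k. d k * z ^ k) sums ((r * a - b * s) / a\<^sup>2 * z * (1 / (1 - \<beta> * z)) + d 0 * z ^ 0)"
      by (rule sums_Suc)
    also have "(r * a - b * s) / a\<^sup>2 * z * (1 / (1 - \<beta> * z)) + d 0 * z ^ 0 = (s + z * r) / (a + z * b)"
    proof -
      have "a * \<beta> = - b" using \<open>a \<noteq> 0\<close> by (simp add: \<beta>_def)
      then show ?thesis
        unfolding ab d_def using ne \<open>a \<noteq> 0\<close>
        by (simp add: divide_simps power2_eq_square) algebra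
    qed
    finally show ?thesis .
  qed
  then have "u k = d k" by (rule powser_coeff_unique[OF sums, rotated])
  then show ?thesis using \<open>k \<ge> 1\<close> by (simp add: d_def \<beta>_def)
qed

theorem theorem10p2:
  fixes p :: bipoly and n :: nat
  assumes "n \<ge> 2"
    and "\<forall>z1 z2. norm z1 < 1 \<and> norm z2 < 1 \<longrightarrow> eval2 p z1 z2 \<noteq> 0"
    and "atoral p"
    and "deg2 p = (1, n)"
    and "deg2 (tilde p) = (1, n)"
    and "N_T2 p (tilde p) = enat (2 * n)"
    and "irreducible p"
    and "\<forall>z1 z2. norm z1 = 1 \<and> norm z2 = 1 \<and> eval2 p z1 z2 = 0 \<longrightarrow> z1 = 1 \<and> z2 = 1"
  shows "\<not> dirichlet2 (\<lambda>z1 z2. eval2 (tilde p) z1 z2 / eval2 p z1 z2)"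
proof
  assume "dirichlet2 (\<lambda>z1 z2. eval2 (tilde p) z1 z2 / eval2 p z1 z2)"
  then obtain u where
    u: "\<And>z1 z2. norm z1 < 1 \<and> norm z2 < 1 \<Longrightarrow>
         ((\<lambda>(k, l). u k l * z1 ^ k * z2 ^ l) has_sum (eval2 (tilde p) z1 z2 / eval2 p z1 z2)) UNIV"
    and energy: "(\<lambda>(k, l). real (k + 1) * real (l + 1) * (norm (u k l))\<^sup>2) summable_on UNIV"
    unfolding dirichlet2_def by blast

  \<comment> \<open>The coefficients of \<open>p\<close> and its zero at
    \<open>(1, 1)\<close>\<close>
  define a b where "a = coeff p 0" and "b = coeff p 1"
  define a' b' where "a' = (\<Sum>l\<le>n. monom (cnj (coeff a l)) (n - l))"
    and "b' = (\<Sum>l\<le>n. monom (cnj (coeff b l)) (n - l))"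
  have deg: "degree p = 1" "Max ((\<lambda>k. degree (coeff p k)) ` {..1}) = n"
    using assms(4) by (auto simp: deg2_def)
  have "degree (coeff p k) \<le> n" if "k \<le> 1" for k
    using that deg(2) Max_ge[of "(\<lambda>k. degree (coeff p k)) ` {..1}" "degree (coeff p k)"] by auto
  then have deg_ab: "degree a \<le> n" "degree b \<le> n" by (auto simp: a_def b_def)
  have ev: "eval2 p z1 z2 = poly a z2 + z1 * poly b z2" for z1 z2
    unfolding a_def b_def by (rule eval2_degree_le_1) (simp add: deg)
  have evt: "eval2 (tilde p) z1 z2 = poly b' z2 + z1 * poly a' z2" for z1 z2
    unfolding a_def b_def a'_def b'_def by (rule eval2_tilde_degree_1[OF assms(4)])
  note nz = assms(2)[rule_format, unfolded ev]
  note torus = assms(8)[rule_format, unfolded ev]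

  \<comment> \<open>Without a torus zero of \<open>p\<close> the sum defining \<open>N_T2\<close>
    would be empty, hence 0 rather than \<open>2 * n\<close>.\<close>
  have "\<exists>z1 z2. norm z1 = 1 \<and> norm z2 = 1 \<and> eval2 p z1 z2 = 0"
  proof (rule ccontr)
    assume "\<not> ?thesis"
    then have "{lam \<in> torus2. eval2 p (fst lam) (snd lam) = 0 \<and>
        eval2 (tilde p) (fst lam) (snd lam) = 0} = {}" by (auto simp: torus2_def)
    then have "N_T2 p (tilde p) = 0" unfolding N_T2_def by (metis sum.empty)
    then show False using assms(1,6) by (simp add: zero_enat_def)
  qed
  then have "eval2 p 1 1 = 0" using assms(8) by metis
  then have ab1: "poly b 1 = - poly a 1" unfolding ev by (simp add: eq_neg_iff_add_eq_0 add.commute)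
  \<comment> \<open>If \<open>a\<close> vanished at 1, so would \<open>b\<close>, and
    \<open>(-1, 1)\<close> would be a second torus zero.\<close>
  have a1: "poly a 1 \<noteq> 0"
    using torus[of "-1" 1] ab1 by auto
  have a_nz: "poly a z \<noteq> 0" if "norm z < 1" for z
    using nz[of 0 z] that by simp
  have b_le_a: "norm (poly b z) \<le> norm (poly a z)" if "norm z < 1" for z
  proof (rule ccontr)
    assume *: "\<not> ?thesis"
    then have "poly b z \<noteq> 0" by auto
    then show False using nz[of "- poly a z / poly b z" z] that * by (simp add: norm_divide)
  qed

  \<comment> \<open>The resultant on the circle and its order at 1\<close>
  define R where "R = a' * a - b * b'"
  have R_T: "norm (poly R \<zeta>) = \<bar>(norm (poly a \<zeta>))\<^sup>2 - (norm (poly b \<zeta>))\<^sup>2\<bar>" if "norm \<zeta> = 1" for \<zeta>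
  proof -
    have "poly R \<zeta> = \<zeta> ^ n * (poly a \<zeta> * cnj (poly a \<zeta>) - poly b \<zeta> * cnj (poly b \<zeta>))"
      unfolding R_def a'_def b'_def
      by (simp add: poly_reflect_unimodular deg_ab that algebra_simps)
    also have "\<dots> = \<zeta> ^ n * of_real ((norm (poly a \<zeta>))\<^sup>2 - (norm (poly b \<zeta>))\<^sup>2)"
      by (simp only: complex_norm_square of_real_diff)
    finally show ?thesis using that by (simp only: norm_mult norm_power norm_of_real) simp
  qed
  have R1: "poly R 1 = 0" using R_T[of 1] ab1 by simp
  have "R \<noteq> 0"
  proof
    assume "R = 0"
    \<comment> \<open>Equal moduli of \<open>a\<close> and \<open>b\<close> at -1 would yield a
      unimodular \<open>z1\<close> with \<open>p\<close> zero at \<open>(z1, -1)\<close>.\<close>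
    then have "(norm (poly a (-1)))\<^sup>2 = (norm (poly b (-1)))\<^sup>2" using R_T[of "-1"] by simp
    then have eq: "norm (poly a (-1)) = norm (poly b (-1))" by simp
    show False
    proof (cases "poly b (-1) = 0")
      case True
      then show ?thesis using eq torus[of 1 "-1"] by simp
    next
      case False
      then show ?thesis using eq torus[of "- poly a (-1) / poly b (-1)" "-1"] by (simp add: norm_divide)
    qed
  qed
  define M where "M = order 1 R"
  have M: "M \<ge> 1" using order_root[of R 1] R1 \<open>R \<noteq> 0\<close> by (simp add: M_def Suc_le_eq)
  obtain q where q: "R = [:-1, 1:] ^ M * q" "poly q 1 \<noteq> 0"
    using order_decomp[OF \<open>R \<noteq> 0\<close>, of 1] unfolding M_def poly_eq_0_iff_dvd by auto
  have R_eq: "norm (poly R z) = norm (z - 1) ^ M * norm (poly q z)" for z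
    by (simp add: q(1) norm_mult norm_power)

  \<comment> \<open>The rows of the double power series\<close>
  define \<beta> where "\<beta> z = - poly b z / poly a z" for z
  define g where "g z = poly R z / (poly a z)\<^sup>2" for z
  define Q where "Q z = poly q z / (poly a z)\<^sup>2" for z
  have row: "(\<lambda>l. u k l * z ^ l) sums (\<beta> z ^ (k - 1) * g z)" if k: "k \<ge> 1" and z: "norm z < 1" for k z
  proof -
    have "((\<lambda>(k, l). u k l * z1 ^ k * z ^ l) has_sum
        ((poly b' z + z1 * poly a' z) / (poly a z + z1 * poly b z))) (Sigma UNIV (\<lambda>_. UNIV))"
      if "norm z1 < 1" for z1
      using u[of z1 z] that z by (simp add: ev evt)
    note us = this
    have row_on: "(\<lambda>l. u k l * z ^ l) summable_on UNIV" for k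
    proof -
      \<comment> \<open>Any nonzero \<open>z1\<close> in the disc serves here: its power is constant
        along a row and can be divided out.\<close>
      have "(\<lambda>l. u k l * (1/2) ^ k * z ^ l) summable_on UNIV"
        using us[of "1/2"] by (intro summable_on_SigmaD1[of _ UNIV "\<lambda>_. UNIV"]) (auto simp: summable_on_def)
      from summable_on_cmult_right[OF this, of "2 ^ k"] show ?thesis
        by (simp add: power_divide)
    qed
    define U where "U k = infsum (\<lambda>l. u k l * z ^ l) UNIV" for k
    have "(\<lambda>k. U k * z1 ^ k) sums ((poly b' z + z1 * poly a' z) / (poly a z + z1 * poly b z))"
      if "norm z1 < 1" for z1
    proof (rule has_sum_imp_sums, rule has_sum_SigmaD[OF us[OF that]])
      fix k
      have "((\<lambda>l. z1 ^ k * (u k l * z ^ l)) has_sum (z1 ^ k * U k)) UNIV"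
        unfolding U_def by (intro has_sum_cmult_right has_sum_infsum row_on)
      then show "((\<lambda>l. case (k, l) of (k, l) \<Rightarrow> u k l * z1 ^ k * z ^ l) has_sum U k * z1 ^ k) UNIV"
        by (simp add: mult_ac)
    qed
    then have "U k = \<beta> z ^ (k - 1) * g z"
      unfolding \<beta>_def g_def R_def poly_diff poly_mult
      using a_nz[OF z] b_le_a[OF z] k by (rule fractional_linear_coeffs)
    then show ?thesis
      using has_sum_imp_sums[OF has_sum_infsum[OF row_on[of k]]] by (simp add: U_def)
  qed

  \<comment> \<open>\<beta> as a self-map of the disc\<close>
  define S0 where "S0 = {z. poly a z \<noteq> 0}"
  have S0: "open S0" "1 \<in> S0"
  proof -
    have "S0 = - (poly a -` {0})" by (auto simp: S0_def)
    then show "open S0" using continuous_closed_vimage[of "{0}" "poly a"] by (simp add: open_Compl)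
  qed (simp add: S0_def a1)
  have hol0: "\<beta> holomorphic_on S0" "g holomorphic_on S0" "Q holomorphic_on S0"
    unfolding \<beta>_def[abs_def] g_def[abs_def] Q_def[abs_def] S0_def
    by (auto intro!: holomorphic_intros)
  have \<beta>1: "\<beta> 1 = 1" using a1 ab1 by (simp add: \<beta>_def)
  have ball: "ball 0 1 \<subseteq> S0" using a_nz by (auto simp: S0_def)
  have \<beta>_lt: "norm (\<beta> z) < 1" if z: "norm z < 1" for z
  proof (rule ccontr)
    assume *: "\<not> norm (\<beta> z) < 1"
    have le: "norm (\<beta> y) \<le> 1" if "norm y < 1" for y
      using b_le_a[OF that] a_nz[OF that] by (simp add: \<beta>_def norm_divide)
    \<comment> \<open>A constant \<beta> would make \<open>b\<close> a multiple of \<open>a\<close>.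
      The values at 1 then give \<open>b = - a\<close>, so \<open>p\<close> would vanish at
      \<open>(1, -1)\<close> as well.\<close>
    have "\<beta> constant_on ball 0 1"
    proof (rule maximum_modulus_principle[of _ _ "ball 0 1" z])
      fix y :: complex assume "y \<in> ball 0 1"
      then show "norm (\<beta> y) \<le> norm (\<beta> z)" using le[of y] * by simp
    qed (use z hol0 ball in \<open>auto intro: holomorphic_on_subset\<close>)
    then obtain c where c: "\<And>y. norm y < 1 \<Longrightarrow> \<beta> y = c" by (auto simp: constant_on_def)
    have "poly (b + smult c a) y = 0" if "y \<in> ball 0 1" for y
      using c[of y] a_nz[of y] that by (auto simp: \<beta>_def)
    moreover have "infinite (ball (0::complex) 1)" using uncountable_ball[of 1 0] countable_finite by auto
    ultimately have "b + smult c a = 0"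
      by (metis (mono_tags, lifting) poly_roots_finite finite_subset mem_Collect_eq subsetI)
    then have bc: "poly b y = - c * poly a y" for y
      by (metis add_eq_0_iff2 minus_mult_left poly_0 poly_add poly_smult)
    then have "c = 1" using ab1 a1 by simp
    then show False using torus[of 1 "-1"] bc[of "-1"] by simp
  qed
  have "(\<beta> has_field_derivative deriv \<beta> 1) (at 1)"
    using hol0(1) S0 by (rule holomorphic_derivI)
  with \<beta>_lt \<beta>1 have \<beta>'1: "deriv \<beta> 1 \<noteq> 0"
    using boundary_fixed_point_deriv_nonzero[OF holomorphic_on_subset[OF hol0(1) ball]] by blast

  \<comment> \<open>Size of \<open>g\<close> near 1 and conclusion\<close>
  have Q1: "Q 1 \<noteq> 0" using q a1 by (simp add: Q_def)
  have "isCont Q 1"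
    using hol0(3) S0 by (meson analytic_at analytic_at_imp_isCont)
  then have "\<forall>\<^sub>F z in nhds 1. dist (Q z) (Q 1) < norm (Q 1) / 2"
    using Q1 unfolding isCont_def tendsto_iff eventually_at_filter
    by (auto elim!: eventually_mono allE[of _ "norm (Q 1) / 2"])
  then obtain \<rho> where \<rho>: "\<rho> > 0" "\<And>z. dist z 1 < \<rho> \<Longrightarrow> dist (Q z) (Q 1) < norm (Q 1) / 2"
    unfolding eventually_nhds_metric by blast
  \<comment> \<open>On \<open>S\<close> the factor \<open>Q\<close> stays within a factor 2 of
    \<open>Q 1\<close> in modulus, so \<open>norm (g z)\<close> is comparable to
    \<open>norm (z - 1) ^ M\<close> from both sides.\<close>
  define S where "S = S0 \<inter> ball 1 \<rho>"
  have S: "open S" "1 \<in> S" using S0 \<rho> by (auto simp: S_def)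
  have Q_bounds: "norm (Q 1) / 2 \<le> norm (Q z) \<and> norm (Q z) \<le> 2 * norm (Q 1)" if "z \<in> S" for z
  proof -
    have "dist (Q z) (Q 1) < norm (Q 1) / 2"
      using that by (intro \<rho>(2)) (auto simp: S_def dist_commute)
    then show ?thesis
      using norm_triangle_sub[of "Q 1" "Q z"] norm_triangle_sub[of "Q z" "Q 1"]
      by (simp add: dist_norm norm_minus_commute)
  qed
  have gQ: "norm (g z) = norm (z - 1) ^ M * norm (Q z)" for z
    by (simp add: g_def Q_def norm_divide R_eq)
  have "\<exists>\<delta>>0. \<forall>\<^sub>F k in sequentially. \<exists>w D. norm w \<le> 1 - 1 / real k \<and>
           ((\<lambda>z. \<beta> z ^ (k - 1) * g z) has_field_derivative D) (at w) \<and> norm D \<ge> \<delta>"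
  proof (rule exists_points_with_large_deriv[OF S _ _ \<beta>1 \<beta>'1 M])
    show "\<beta> holomorphic_on S" "g holomorphic_on S"
      using hol0 by (auto simp: S_def intro: holomorphic_on_subset)
    show "0 \<le> 2 * norm (Q 1)" "0 < norm (Q 1) / 2" using Q1 by auto
    show "norm (Q 1) / 2 * norm (w - 1) ^ M \<le> norm (g w)" if "w \<in> S" for w
      unfolding gQ mult.commute[of "norm (w - 1) ^ M"]
      using Q_bounds[OF that] by (intro mult_right_mono) auto
    show "1 - 2 * norm (Q 1) * norm (\<zeta> - 1) ^ M \<le> norm (\<beta> \<zeta>)" if \<zeta>: "\<zeta> \<in> S" "norm \<zeta> = 1" for \<zeta>
    proof -
      have a\<zeta>: "poly a \<zeta> \<noteq> 0" using \<zeta> by (auto simp: S_def S0_def)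
      \<comment> \<open>The circle identity for \<open>R\<close>, divided by
        \<open>(norm (poly a \<zeta>))\<^sup>2\<close>, lets the upper bound on \<open>g\<close>
        control how far \<beta> drops below modulus 1.\<close>
      have "norm (g \<zeta>) = \<bar>1 - (norm (\<beta> \<zeta>))\<^sup>2\<bar>"
      proof -
        have "norm (g \<zeta>) = \<bar>((norm (poly a \<zeta>))\<^sup>2 - (norm (poly b \<zeta>))\<^sup>2) / (norm (poly a \<zeta>))\<^sup>2\<bar>"
          by (simp add: g_def norm_divide norm_power R_T[OF \<zeta>(2)])
        then show ?thesis using a\<zeta> by (simp add: \<beta>_def norm_divide power_divide diff_divide_distrib)
      qed
      moreover have "1 - norm (\<beta> \<zeta>) \<le> \<bar>1 - (norm (\<beta> \<zeta>))\<^sup>2\<bar>"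
      proof (cases "norm (\<beta> \<zeta>) \<le> 1")
        case True
        then have "(norm (\<beta> \<zeta>))\<^sup>2 \<le> norm (\<beta> \<zeta>)" by (simp add: power2_eq_square mult_left_le)
        then show ?thesis by simp
      next
        case False
        then have "1 - norm (\<beta> \<zeta>) \<le> 0" by simp
        then show ?thesis by (rule order_trans) simp
      qed
      moreover have "norm (g \<zeta>) \<le> 2 * norm (Q 1) * norm (\<zeta> - 1) ^ M"
        unfolding gQ mult.commute[of "norm (\<zeta> - 1) ^ M"]
        using Q_bounds[OF \<zeta>(1)] by (intro mult_right_mono) auto
      ultimately show ?thesis by simp
    qed
  qed
  then obtain \<delta> where "\<delta> > 0" "\<forall>\<^sub>F k in sequentially. \<exists>w D. norm w \<le> 1 - 1 / real k \<and>
           ((\<lambda>z. \<beta> z ^ (k - 1) * g z) has_field_derivative D) (at w) \<and> norm D \<ge> \<delta>" by blast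
  from Dirichlet_energy_diverges[OF row this] energy show False by blast
qed

end
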